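(* Let $G$ be a finite, simple, undirected, connected graph with at least two vertices. If $\gamma_t(G) = i_0(G) + 1$, then $G$ has a dominating vertex, i.e. a vertex adjacent to every other vertex of $G$.
   Context: A set $S \subseteq V(G)$ is a total dominating set of $G$ if every vertex of $G$ (including those in $S$) has a neighbor in $S$; $\gamma_t(G)$ is the minimum cardinality of a total dominating set. A set $S \subseteq V(G)$ is an isolate set if the induced subgraph $G[S]$ has at least one isolated vertex (a vertex of degree $0$ in $G[S]$). An isolate set is maximal if no proper superset of it is an isolate set. The isolate number $i_0(G)$ is the minimum cardinality of a maximal isolate set of $G$. *)

theory Defs
  imports "Graph_Theory.Digraph_Component"
begin

text \<open>
  A finite simple undirected graph is a term \<open>G\<close> with \<^prop>\<open>graph G\<close>: a finite symmetric digraph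
  without loops or parallel arcs. An undirected edge \<open>uv\<close> is the pair of opposite arcs joining
  \<open>u\<close> and \<open>v\<close>, so adjacency is \<open>u \<rightarrow>\<^bsub>G\<^esub> v\<close> and the undirected degree of a vertex is its
  \<^const>\<open>out_degree\<close>.
\<close>

definition total_dominating_set :: "('a, 'b) pre_digraph \<Rightarrow> 'a set \<Rightarrow> bool" where
  "total_dominating_set G S \<longleftrightarrow> S \<subseteq> verts G \<and> (\<forall>v \<in> verts G. \<exists>u \<in> S. v \<rightarrow>\<^bsub>G\<^esub> u)"

text \<open>
  The \<open>LEAST\<close> below is the intended minimum only if \<open>G\<close> has a total dominating set, that is, if
  \<open>G\<close> is finite without isolated vertices; every finite connected graph with at least two vertices
  qualifies.
\<close>

definition total_domination_number :: "('a, 'b) pre_digraph \<Rightarrow> nat" where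
  "total_domination_number G = (LEAST k. \<exists>S. total_dominating_set G S \<and> card S = k)"

definition isolate_set :: "('a, 'b) pre_digraph \<Rightarrow> 'a set \<Rightarrow> bool" where
  "isolate_set G S \<longleftrightarrow> S \<subseteq> verts G \<and> (\<exists>v \<in> S. out_degree (G \<restriction> S) v = 0)"

definition maximal_isolate_set :: "('a, 'b) pre_digraph \<Rightarrow> 'a set \<Rightarrow> bool" where
  "maximal_isolate_set G S \<longleftrightarrow> isolate_set G S \<and> (\<forall>T. S \<subset> T \<longrightarrow> \<not> isolate_set G T)"

text \<open>
  Singletons are isolate sets, so every finite graph with a vertex has a maximal isolate set.
\<close>

definition isolate_number :: "('a, 'b) pre_digraph \<Rightarrow> nat" where
  "isolate_number G = (LEAST k. \<exists>S. maximal_isolate_set G S \<and> card S = k)"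

definition dominating_vertex :: "('a, 'b) pre_digraph \<Rightarrow> 'a \<Rightarrow> bool" where
  "dominating_vertex G v \<longleftrightarrow> v \<in> verts G \<and> (\<forall>u \<in> verts G. u \<noteq> v \<longrightarrow> v \<rightarrow>\<^bsub>G\<^esub> u)"

end

theory Submission
  imports Defs
begin

text \<open>
  Let \<open>S\<close> be a minimum maximal isolate set and \<open>v\<close> isolated in \<open>G[S]\<close>; by maximality every isolated
  vertex of \<open>G[S]\<close> is adjacent to everything outside \<open>S\<close>. If \<open>S = {v}\<close>, then \<open>v\<close> is dominating.
  Otherwise connectedness gives an edge \<open>r x\<close> with \<open>r \<in> S - {v}\<close> and \<open>x \<notin> S\<close>, and exchanging a
  suitable \<open>y \<in> S - {v}\<close> for \<open>x\<close> turns \<open>S\<close> into a total dominating set of size \<open>|S| = i\<^sub>0(G)\<close>.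
  The exchange can only fail for \<open>y\<close> if some \<open>z \<in> S\<close>, not adjacent to \<open>x\<close>, has \<open>y\<close> as its only
  neighbour in \<open>S\<close>; failure for all \<open>y\<close> would inject \<open>S - {v}\<close> into the smaller set \<open>S - {v, r}\<close>.
\<close>

lemma (in wf_digraph) reachable_leaves_set:
  assumes "u \<rightarrow>\<^sup>*\<^bsub>G\<^esub> w" "u \<in> A" "w \<notin> A"
  shows "\<exists>a\<in>A. \<exists>b. b \<notin> A \<and> a \<rightarrow>\<^bsub>G\<^esub> b"
  using assms by (induction rule: converse_reachable_induct) auto

lemma (in fin_digraph) out_degree_induce_eq_0_iff:
  assumes "v \<in> S"
  shows "out_degree (G \<restriction> S) v = 0 \<longleftrightarrow> (\<forall>u\<in>S. \<not> v \<rightarrow>\<^bsub>G\<^esub> u)"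
proof -
  \<comment> \<open>\<open>card\<close> is 0 on infinite sets too, so degree 0 yields an empty arc
    set only once finiteness is known.\<close>
  have "finite (out_arcs (G \<restriction> S) v)"
    by (rule finite_subset[OF _ finite_arcs]) auto
  then have "out_degree (G \<restriction> S) v = 0 \<longleftrightarrow> out_arcs (G \<restriction> S) v = {}"
    by (simp add: out_degree_def)
  also have "\<dots> \<longleftrightarrow> (\<forall>u\<in>S. \<not> v \<rightarrow>\<^bsub>G\<^esub> u)"
    using assms by (fastforce simp: arcs_ends_conv image_iff)
  finally show ?thesis .
qed

lemma (in fin_digraph) isolate_set_iff:
  "isolate_set G S \<longleftrightarrow> S \<subseteq> verts G \<and> (\<exists>v\<in>S. \<forall>u\<in>S. \<not> v \<rightarrow>\<^bsub>G\<^esub> u)"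
  unfolding isolate_set_def using out_degree_induce_eq_0_iff by blast

lemma (in digraph) maximal_isolate_set_exists:
  assumes "verts G \<noteq> {}"
  shows "\<exists>S. maximal_isolate_set G S"
proof -
  obtain v where v: "v \<in> verts G" using assms by blast
  have "isolate_set G {v}"
    using v by (auto simp: isolate_set_iff dest: adj_not_same)
  moreover have "finite {S. isolate_set G S}"
    by (rule finite_subset[of _ "Pow (verts G)"]) (auto simp: isolate_set_def)
  ultimately have "\<exists>S\<in>{S. isolate_set G S}. \<forall>T\<in>{S. isolate_set G S}. S \<subseteq> T \<longrightarrow> S = T"
    by (intro finite_has_maximal) blast+
  then show ?thesis
    unfolding maximal_isolate_set_def psubset_eq by blast
qed

lemma (in digraph) isolate_number_attained:
  assumes "verts G \<noteq> {}"
  obtains S where "maximal_isolate_set G S" "card S = isolate_number G"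
proof -
  have "\<exists>k S. maximal_isolate_set G S \<and> card S = k"
    using maximal_isolate_set_exists[OF assms] by auto
  then have "\<exists>S. maximal_isolate_set G S \<and> card S = isolate_number G"
    unfolding isolate_number_def by (rule LeastI_ex)
  with that show ?thesis by blast
qed

lemma total_domination_number_le:
  "total_dominating_set G S \<Longrightarrow> total_domination_number G \<le> card S"
  unfolding total_domination_number_def by (rule Least_le) blast

text \<open>Otherwise \<open>w\<close> would stay isolated when \<open>z\<close> joins
  \<open>S\<close>, giving a larger isolate set.\<close>

lemma (in fin_digraph) maximal_isolate_set_adj_outside:
  assumes S: "maximal_isolate_set G S"
    and w: "w \<in> S" "\<forall>u\<in>S. \<not> w \<rightarrow>\<^bsub>G\<^esub> u"
    and z: "z \<in> verts G" "z \<notin> S"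
  shows "w \<rightarrow>\<^bsub>G\<^esub> z"
proof (rule ccontr)
  assume "\<not> w \<rightarrow>\<^bsub>G\<^esub> z"
  then have "isolate_set G (insert z S)"
    using S w z by (auto simp: maximal_isolate_set_def isolate_set_iff)
  moreover have "S \<subset> insert z S" using z by blast
  ultimately show False using S by (auto simp: maximal_isolate_set_def)
qed

lemma (in graph) total_dominating_exchange:
  assumes S: "maximal_isolate_set G S"
    and v: "v \<in> S" "\<forall>u\<in>S. \<not> v \<rightarrow>\<^bsub>G\<^esub> u"
    and r: "r \<in> S" "r \<noteq> v" "r \<rightarrow>\<^bsub>G\<^esub> x" and x: "x \<notin> S"
  shows "\<exists>y\<in>S. total_dominating_set G (insert x (S - {y}))"
proof (rule ccontr)
  assume none: "\<not> ?thesis"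
  have sub: "S \<subseteq> verts G" using S by (auto simp: maximal_isolate_set_def isolate_set_iff)
  then have fin: "finite S" using finite_verts by (rule finite_subset)
  have xG: "x \<in> verts G" using r(3) by (rule adj_in_verts)
  note out = maximal_isolate_set_adj_outside[OF S]
  have "\<exists>z \<in> S - {v, r}. {u \<in> S. z \<rightarrow>\<^bsub>G\<^esub> u} = {y}" if y: "y \<in> S - {v}" for y
  proof -
    let ?D = "insert x (S - {y})"
    have "?D \<subseteq> verts G" using sub xG by auto
    moreover have "\<not> total_dominating_set G ?D" using none y by blast
    ultimately obtain z where z: "z \<in> verts G" "\<And>u. u \<in> ?D \<Longrightarrow> \<not> z \<rightarrow>\<^bsub>G\<^esub> u"
      unfolding total_dominating_set_def by blast
    \<comment> \<open>A vertex outside \<open>S\<close> is adjacent to \<open>v\<close>, and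
      \<open>v\<close> survives the exchange because \<open>y \<noteq> v\<close>.\<close>
    have zS: "z \<in> S"
    proof (rule ccontr)
      assume "z \<notin> S"
      from out[OF v z(1) this] have "z \<rightarrow>\<^bsub>G\<^esub> v" by (rule arcs_ends_symmetric[OF sym_arcs])
      with z(2) v(1) y show False by auto
    qed
    have zx: "\<not> z \<rightarrow>\<^bsub>G\<^esub> x" using z(2) by blast
    \<comment> \<open>If \<open>z\<close> had no neighbour in \<open>S\<close>, maximality would
      make it adjacent to \<open>x\<close>. That neighbour must be \<open>y\<close>, the only vertex
      of \<open>S\<close> missing from \<open>?D\<close>.\<close>
    then obtain u where "u \<in> S" "z \<rightarrow>\<^bsub>G\<^esub> u" using out[OF zS _ xG x] by blast
    then have "{u \<in> S. z \<rightarrow>\<^bsub>G\<^esub> u} = {y}" using z(2) by blast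
    moreover have "z \<noteq> v" "z \<noteq> r" using zx out[OF v xG x] r(3) by auto
    ultimately show ?thesis using zS by blast
  qed
  then obtain f where f: "\<And>y. y \<in> S - {v} \<Longrightarrow> f y \<in> S - {v, r} \<and> {u \<in> S. f y \<rightarrow>\<^bsub>G\<^esub> u} = {y}"
    by metis
  \<comment> \<open>\<open>y\<close> is recovered from \<open>f y\<close> as its only neighbour in
    \<open>S\<close>.\<close>
  have "inj_on f (S - {v})"
    by (rule inj_onI) (metis f singleton_inject)
  moreover have "f ` (S - {v}) \<subseteq> S - {v, r}" using f by blast
  ultimately have "card (S - {v}) \<le> card (S - {v, r})"
    using fin by (intro card_inj_on_le) auto
  moreover have "card (S - {v, r}) < card (S - {v})"
    using fin r by (intro psubset_card_mono) auto
  ultimately show False by simp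
qed

theorem theorem2p4:
  fixes G :: "('a, 'b) pre_digraph"
  assumes "graph G"
    and "Digraph_Component.connected G"
    and "card (verts G) \<ge> 2"
    and "total_domination_number G = isolate_number G + 1"
  shows "\<exists>v. dominating_vertex G v"
proof -
  interpret graph G by fact
  have "verts G \<noteq> {}" using assms(3) by auto
  then obtain S where S: "maximal_isolate_set G S" "card S = isolate_number G"
    by (rule isolate_number_attained)
  then obtain v where v: "v \<in> S" "\<forall>u\<in>S. \<not> v \<rightarrow>\<^bsub>G\<^esub> u" and sub: "S \<subseteq> verts G"
    by (auto simp: maximal_isolate_set_def isolate_set_iff)
  have fin: "finite S" using sub finite_verts by (rule finite_subset)
  have "S = {v}"
  proof (rule ccontr)
    assume "S \<noteq> {v}"
    with v(1) obtain s where s: "s \<in> S - {v}" by blast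
    \<comment> \<open>A walk from \<open>s\<close> to \<open>v\<close> must leave
      \<open>S - {v}\<close>. The crossing arc cannot end at \<open>v\<close>, which by symmetry
      would then have a neighbour in \<open>S\<close>, so it ends outside \<open>S\<close>.\<close>
    have "strongly_connected G"
      using symmetric_connected_imp_strongly_connected[OF sym_arcs assms(2)] .
    then have "s \<rightarrow>\<^sup>*\<^bsub>G\<^esub> v" using s v(1) sub by blast
    then obtain r x where rx: "r \<in> S - {v}" "x \<notin> S - {v}" "r \<rightarrow>\<^bsub>G\<^esub> x"
      using reachable_leaves_set[of s v "S - {v}"] s by blast
    have "x \<noteq> v" using rx v(2) arcs_ends_symmetric[OF sym_arcs] by blast
    with rx have x: "x \<notin> S" by blast
    from rx obtain y where y: "y \<in> S" "total_dominating_set G (insert x (S - {y}))"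
      using total_dominating_exchange[OF S(1) v _ _ _ x, of r] by blast
    have "card (insert x (S - {y})) = card S"
      using x card.remove[OF fin y(1)] fin by simp
    with total_domination_number_le[OF y(2)] S(2) assms(4) show False by simp
  qed
  then have "dominating_vertex G v"
    using sub maximal_isolate_set_adj_outside[OF S(1) v] by (auto simp: dominating_vertex_def)
  then show ?thesis ..
qed

end
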